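(* Let $n\ge3$, $0<k<n-2$, let $Q_k>0$ be the constant fixed in the context, and let $g:\mathbb{R}^n\times\mathbb{R}\times\mathbb{R}^n\to\mathbb{R}$, $g=g(x,z,p)$, satisfy: (H1) for every $x\in\mathbb{R}^n$, $g(x,\cdot,\cdot)\in C^1\big((\mathbb{R}\times\mathbb{R}^n)\setminus\{(0,0)\}\big)\cap C(\mathbb{R}\times\mathbb{R}^n)$; (H2) the function $x\mapsto g(x,0,0)$ belongs to $E_{k+2}$; (H3) there exists $\delta>0$ such that $\sup_{0<\|w\|_{F_k}\le\delta}\|D_{(z,p)}g(\cdot,w,Dw)\|_{E_2}<\infty$. Suppose $\varepsilon>0$ is such that $\sup_{0<\|w\|_{F_k}\le\varepsilon}\|D_{(z,p)}g(\cdot,w,Dw)\|_{E_2}<Q_k$ and $\|g(\cdot,0,0)\|_{E_{k+2}}\le\varepsilon Q_k$. Let $u$ be the unique function in $F_k$ with $\|u\|_{F_k}\le\varepsilon$ satisfying $$u(x)=\frac{1}{(n-2)\omega_n}\int_{\mathbb{R}^n}\frac{1}{|x-y|^{n-2}}\,g(y,u(y),Du(y))\,dy\quad\text{for all }x\in\mathbb{R}^n .$$ If $\lim_{|x|\to\infty}(1+|x|)^{k+2}|g(x,0,0)|=0$, then $$\lim_{|x|\to\infty}(1+|x|)^k\big(|u(x)|+|Du(x)|\big)=0 .$$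
   Context: $\omega_n$ is the area of the unit sphere in $\mathbb{R}^n$. For $k\in\mathbb{R}$, $E_k$ is the Banach space of measurable functions $u$ on $\mathbb{R}^n$ with $\|u\|_{E_k}=\operatorname{ess\,sup}_{x\in\mathbb{R}^n}(1+|x|)^k|u(x)|<\infty$ (for vector-valued functions, $|\cdot|$ is the Euclidean norm). $F_k$ is the Banach space of $u\in C^1(\mathbb{R}^n)$ with $\|u\|_{F_k}=\sup_{x\in\mathbb{R}^n}(1+|x|)^k(|u(x)|+|Du(x)|)<\infty$. $D_{(z,p)}g(x,z,p)\in\mathbb{R}^{n+1}$ denotes the gradient of $g$ with respect to the last $n+1$ variables $(z,p)$, and $D_{(z,p)}g(\cdot,w,Dw)$ is the function $x\mapsto D_{(z,p)}g(x,w(x),Dw(x))$. The suprema are over $w\in F_k$ with the indicated norm bounds; since $g(x,\cdot,\cdot)$ need not be differentiable at $(0,0)$, the norm $\|D_{(z,p)}g(\cdot,w,Dw)\|_{E_2}$ is computed over those $x$ with $(w(x),Dw(x))\ne(0,0)$. The finiteness of these norms includes the requirement that the functions involved are measurable. The constant $Q_k$: for $0<k<n-2$ there is a constant $C_k>0$ such that $\|N(f)\|_{F_k}\le C_k\|f\|_{E_{k+2}}$ for all $f\in E_{k+2}$, where $N(f)(x)=\frac{1}{(n-2)\omega_n}\int_{\mathbb{R}^n}|x-y|^{2-n}f(y)\,dy$. Fix such a $C_k$ and set $Q_k=\frac{1}{2C_k}$. Under the stated hypotheses on $g$ and $\varepsilon$, the integral equation has exactly one solution $u\in F_k$ with $\|u\|_{F_k}\le\varepsilon$.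 *)

theory Defs
  imports "HOL-Probability.Essential_Supremum" "HOL-Analysis.Analysis"
begin

text \<open>
  Measurability, essential suprema and integrals are with respect to Lebesgue measure, and norms
  are \<^typ>\<open>ennreal\<close>-valued, so that a function lies outside a space exactly when its norm is
  \<open>\<infinity>\<close> (or, for \<open>F_space\<close>, when it is not \<open>C\<^sup>1\<close>).
\<close>

text \<open>Unspecified at points where \<open>f\<close> is not differentiable.\<close>

definition grad :: "('a::real_inner \<Rightarrow> real) \<Rightarrow> 'a \<Rightarrow> 'a" where
  "grad f x = (THE D. GDERIV f x :> D)"

definition C1_on :: "'a::euclidean_space set \<Rightarrow> ('a \<Rightarrow> real) \<Rightarrow> bool" where
  "C1_on S f \<longleftrightarrow> (\<forall>x\<in>S. f differentiable (at x)) \<and> continuous_on S (grad f)"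

text \<open>
  The \<open>E\<^sub>m\<close> norm computed over the points of \<open>S\<close> only; it is \<open>\<infinity>\<close> when \<open>u\<close> is not measurable
  on \<open>S\<close>. The values of \<open>u\<close> outside \<open>S\<close> play no role.
\<close>

definition E_norm_on ::
    "(real^'n) set \<Rightarrow> real \<Rightarrow> (real^'n \<Rightarrow> 'b::real_normed_vector) \<Rightarrow> ennreal" where
  "E_norm_on S m u =
     (if u \<in> borel_measurable (lebesgue_on S)
      then esssup (lebesgue_on S) (\<lambda>x. ennreal ((1 + norm x) powr m * norm (u x)))
      else \<infinity>)"

abbreviation E_norm :: "real \<Rightarrow> (real^'n \<Rightarrow> 'b::real_normed_vector) \<Rightarrow> ennreal" where
  "E_norm \<equiv> E_norm_on UNIV"

definition E_space :: "real \<Rightarrow> (real^'n \<Rightarrow> 'b::real_normed_vector) set" where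
  "E_space m = {u. E_norm m u < \<infinity>}"

definition F_norm :: "real \<Rightarrow> (real^'n \<Rightarrow> real) \<Rightarrow> ennreal" where
  "F_norm m u = (SUP x. ennreal ((1 + norm x) powr m * (\<bar>u x\<bar> + norm (grad u x))))"

definition F_space :: "real \<Rightarrow> (real^'n \<Rightarrow> real) set" where
  "F_space m = {u. C1_on UNIV u \<and> F_norm m u < \<infinity>}"

text \<open>The area of the unit sphere of \<open>\<real>\<^sup>n\<close> is \<open>n\<close> times the volume of the unit ball.\<close>

definition unit_sphere_area :: "nat \<Rightarrow> real" where
  "unit_sphere_area n = real n * unit_ball_vol (real n)"

definition newton_potential :: "(real^'n \<Rightarrow> real) \<Rightarrow> real^'n \<Rightarrow> real" where
  "newton_potential f x =
     1 / ((real CARD('n) - 2) * unit_sphere_area CARD('n)) *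
     (LINT y|lebesgue. 1 / norm (x - y) ^ (CARD('n) - 2) * f y)"

text \<open>The gradient \<open>D\<^bsub>(z,p)\<^esub> g(x,z,p)\<close>; the norm on the product type is the Euclidean one.\<close>

definition D_zp ::
    "(real^'n \<Rightarrow> real \<Rightarrow> real^'n \<Rightarrow> real) \<Rightarrow> real^'n \<Rightarrow> real \<Rightarrow> real^'n \<Rightarrow> real \<times> (real^'n)" where
  "D_zp g x z p = grad (\<lambda>(z, p). g x z p) (z, p)"

text \<open>
  The supremum of \<open>\<parallel>D\<^bsub>(z,p)\<^esub> g(\<cdot>,w,Dw)\<parallel>\<close> in \<open>E\<^sub>2\<close> over \<open>0 < \<parallel>w\<parallel> \<le> r\<close> in \<open>F\<^sub>k\<close>. Each norm is computed over the
  \<open>x\<close> with \<open>(w(x), Dw(x)) \<noteq> (0,0)\<close>, since \<open>g(x,\<cdot>,\<cdot>)\<close> need not be differentiable at the origin.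
\<close>

definition D_zp_sup ::
    "real \<Rightarrow> (real^'n \<Rightarrow> real \<Rightarrow> real^'n \<Rightarrow> real) \<Rightarrow> real \<Rightarrow> ennreal" where
  "D_zp_sup k g r =
     (SUP w\<in>{w \<in> F_space k. 0 < F_norm k w \<and> F_norm k w \<le> ennreal r}.
        E_norm_on {x. (w x, grad w x) \<noteq> (0, 0)} 2 (\<lambda>x. D_zp g x (w x) (grad w x)))"

end

theory Submission imports Defs begin

text \<open>
  Let \<open>f = g(\<cdot>,u,Du)\<close> and \<open>\<phi> = (1 + |x|)\<^sup>k (|u| + |Du|)\<close>. The mean value theorem on the segment
  from \<open>(0,0)\<close> to \<open>(u,Du)\<close> gives \<open>|f| \<le> |g(\<cdot>,0,0)| + M (1 + |x|)\<^sup>-\<^sup>2 (|u| + |Du|)\<close> almost everywhere, with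
  \<open>C M \<le> 1/2\<close>. Cut \<open>f\<close> at a large radius \<open>R\<close>: the potential of the inner part decays like \<open>|x|\<^sup>2\<^sup>-\<^sup>n\<close>
  together with its gradient, and \<open>k < n - 2\<close>, while the potential of the outer part is controlled in
  \<open>F\<^sub>k\<close> by \<open>C\<close> times the supremum of \<open>(1 + |x|)\<^bsup>k+2\<^esup> |f|\<close> over \<open>|x| > R\<close>. So an eventual bound \<open>\<phi> \<le> b\<close>
  improves to \<open>\<phi> \<le> b/2 + e\<close> for every \<open>e > 0\<close>, which forces \<open>\<phi> \<longlongrightarrow> 0\<close>.

  If \<open>f\<close> is not measurable, the integrand of its potential is nowhere integrable, the integral is \<open>0\<close>
  by convention, and \<open>u = 0\<close>.
\<close>

section \<open>Gradients of real functions\<close>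

text \<open>\<open>grad\<close> is a definite description, so it can be evaluated only once
  gradients are unique. Two candidates induce the same functional, and testing it on their
  difference makes the difference vanish.\<close>

lemma GDERIV_unique:
  assumes "GDERIV f x :> D" "GDERIV f x :> D'"
  shows "D = D'"
proof -
  have "(\<lambda>h. inner h D) = (\<lambda>h. inner h D')"
    using assms has_derivative_unique unfolding gderiv_def by blast
  then have "inner (D - D') D = inner (D - D') D'"
    by metis
  then have "inner (D - D') (D - D') = 0"
    by (simp add: inner_diff_right)
  then show ?thesis
    by simp
qed

lemma grad_eq: "GDERIV f x :> D \<Longrightarrow> grad f x = D"
  unfolding grad_def using GDERIV_unique by blast

text \<open>A linear functional is the inner product with the vector of its values on
  \<open>Basis\<close>; for the derivative this vector is the gradient.\<close>

lemma GDERIV_grad: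
  fixes f :: "'a::euclidean_space \<Rightarrow> real"
  assumes "f differentiable (at x)"
  shows "GDERIV f x :> grad f x"
proof -
  obtain f' where f': "(f has_derivative f') (at x)"
    using assms by (auto simp: differentiable_def)
  then interpret bounded_linear f'
    by (rule has_derivative_bounded_linear)
  have "f' = (\<lambda>h. inner h (\<Sum>b\<in>Basis. f' b *\<^sub>R b))"
  proof
    fix h
    have "f' h = f' (\<Sum>b\<in>Basis. inner h b *\<^sub>R b)"
      by (simp add: euclidean_representation)
    also have "\<dots> = (\<Sum>b\<in>Basis. inner h b * f' b)"
      by (simp add: sum scaleR)
    finally show "f' h = inner h (\<Sum>b\<in>Basis. f' b *\<^sub>R b)"
      by (simp add: inner_sum_right mult.commute)
  qed
  then have "GDERIV f x :> (\<Sum>b\<in>Basis. f' b *\<^sub>R b)"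
    using f' by (simp add: gderiv_def)
  then show ?thesis
    using grad_eq by metis
qed

text \<open>The difference quotient in the direction \<open>D = grad f x\<close> tends to |D|^2,
  while the Lipschitz estimate caps it at L |D|. This bounds the gradient of a potential without
  differentiating under the integral.\<close>

lemma norm_grad_le_local_Lipschitz:
  fixes f :: "'a::euclidean_space \<Rightarrow> real"
  assumes diff: "f differentiable (at x)"
    and L: "L \<ge> 0" and r: "r > 0"
    and lip: "\<And>y. y \<in> ball x r \<Longrightarrow> \<bar>f y - f x\<bar> \<le> L * norm (y - x)"
  shows "norm (grad f x) \<le> L"
proof (cases "grad f x = 0")
  case False
  define D where "D = grad f x"
  define \<phi> where "\<phi> = (\<lambda>t::real. f (x + t *\<^sub>R D))"
  have f': "(f has_derivative (\<lambda>h. inner h D)) (at (x + 0 *\<^sub>R D))"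
    using GDERIV_grad[OF diff] by (simp add: gderiv_def D_def)
  have "((\<lambda>t::real. x + t *\<^sub>R D) has_derivative (\<lambda>t. t *\<^sub>R D)) (at 0)"
    by (auto intro!: derivative_eq_intros)
  from has_derivative_compose[OF this f']
  have "(\<phi> has_field_derivative (inner D D)) (at 0)"
    by (simp add: \<phi>_def has_field_derivative_def mult_commute_abs)
  then have lim: "((\<lambda>t. \<bar>(\<phi> t - \<phi> 0) / t\<bar>) \<longlongrightarrow> \<bar>inner D D\<bar>) (at 0)"
    by (intro tendsto_rabs) (simp add: has_field_derivative_iff)
  have Dpos: "norm D > 0"
    using False by (simp add: D_def)
  have "eventually (\<lambda>t. t \<noteq> 0 \<and> \<bar>t\<bar> < r / norm D) (at (0::real))"
    unfolding eventually_at using r Dpos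
    by (intro exI[of _ "r / norm D"]) (auto simp: dist_norm)
  then have "eventually (\<lambda>t. \<bar>(\<phi> t - \<phi> 0) / t\<bar> \<le> L * norm D) (at 0)"
  proof eventually_elim
    case (elim t)
    have "\<bar>t\<bar> * norm D < r"
      using elim Dpos by (simp add: pos_less_divide_eq)
    then have "\<bar>\<phi> t - \<phi> 0\<bar> \<le> L * (\<bar>t\<bar> * norm D)"
      using lip[of "x + t *\<^sub>R D"] by (simp add: \<phi>_def dist_norm)
    then show ?case
      using elim by (simp add: abs_divide divide_le_eq mult_ac)
  qed
  then have "\<bar>inner D D\<bar> \<le> L * norm D"
    by (intro tendsto_upperbound[OF lim]) auto
  then have "norm D * norm D \<le> L * norm D"
    by (simp add: dot_square_norm power2_eq_square)
  then show ?thesis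
    using Dpos by (simp add: D_def)
qed (use L in simp)

section \<open>Integrability of powers of the distance\<close>

lemma ex_dyadic:
  fixes t :: real
  assumes "1 \<le> t"
  shows "\<exists>j::nat. 2 ^ j \<le> t \<and> t \<le> 2 ^ Suc j"
proof -
  define j where "j = nat \<lfloor>log 2 t\<rfloor>"
  have "0 \<le> log 2 t"
    using assms by simp
  then have "real j \<le> log 2 t" "log 2 t \<le> real (Suc j)"
    unfolding j_def by linarith+
  then show ?thesis
    using assms by (intro exI[of _ j]) (simp add: le_log_iff log_le_iff powr_add flip: powr_realpow)
qed

text \<open>In dimension n the volume of the j-th ball scales like \<open>\<rho>\<close>^(n j), so
  the integrals of the terms form a geometric series of ratio q \<open>\<rho>\<close>^n.\<close>

lemma nn_integral_dyadic_finite: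
  fixes x :: "'a::euclidean_space"
  assumes "0 \<le> q" "0 \<le> \<rho>" "q * \<rho> ^ DIM('a) < 1" "0 \<le> c" "0 \<le> d"
  shows "(\<integral>\<^sup>+y. (\<Sum>j. ennreal (c * q ^ j) * indicator (cball x (d * \<rho> ^ j)) y) \<partial>lborel) < \<infinity>"
proof -
  define K where "K = c * unit_ball_vol (real DIM('a)) * d ^ DIM('a)"
  have "(\<integral>\<^sup>+y. (\<Sum>j. ennreal (c * q ^ j) * indicator (cball x (d * \<rho> ^ j)) y) \<partial>lborel)
      = (\<Sum>j. \<integral>\<^sup>+y. ennreal (c * q ^ j) * indicator (cball x (d * \<rho> ^ j)) y \<partial>lborel)"
    by (rule nn_integral_suminf) (auto intro!: borel_measurable_times_ennreal borel_measurable_indicator)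
  also have "\<dots> = (\<Sum>j. ennreal (K * (q * \<rho> ^ DIM('a)) ^ j))"
  proof (rule suminf_cong)
    fix j
    have "(\<integral>\<^sup>+y. ennreal (c * q ^ j) * indicator (cball x (d * \<rho> ^ j)) y \<partial>lborel)
        = ennreal (c * q ^ j) * ennreal (unit_ball_vol (real DIM('a)) * (d * \<rho> ^ j) ^ DIM('a))"
      using assms by (subst nn_integral_cmult_indicator) (auto simp: emeasure_cball)
    also have "\<dots> = ennreal (K * (q * \<rho> ^ DIM('a)) ^ j)"
      using assms
      by (subst ennreal_mult[symmetric])
         (auto simp: K_def power_mult_distrib mult_ac simp flip: power_mult)
    finally show "(\<integral>\<^sup>+y. ennreal (c * q ^ j) * indicator (cball x (d * \<rho> ^ j)) y \<partial>lborel)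
        = ennreal (K * (q * \<rho> ^ DIM('a)) ^ j)" .
  qed
  also have "\<dots> = ennreal (\<Sum>j. K * (q * \<rho> ^ DIM('a)) ^ j)"
    using assms by (intro suminf_ennreal2) (auto simp: K_def intro!: summable_mult summable_geometric)
  also have "\<dots> < \<infinity>"
    by simp
  finally show ?thesis .
qed

text \<open>As a < b, the minimum is the power -a inside the unit ball about \<open>x\<close> and
  the power -b outside. In dimension n, a < n makes the singularity integrable and b > n the
  tail.\<close>

lemma integrable_min_norm_powr:
  fixes x :: "'a::euclidean_space" and a b :: real
  assumes a: "0 \<le> a" "a < DIM('a)" and b: "DIM('a) < b"
  shows "integrable lborel (\<lambda>y. min (norm (x - y) powr - a) (norm (x - y) powr - b))"
proof (rule integrableI_bounded)
  let ?n = "DIM('a)"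
  \<comment> \<open>\<open>S1\<close> dominates \<open>|x - y|\<^sup>-\<^sup>a\<close> near \<open>x\<close> and \<open>S2\<close> dominates \<open>|x - y|\<^sup>-\<^sup>b\<close> far from \<open>x\<close>,
    through the dyadic scale of \<open>|x - y|\<close>.\<close>
  define S1 where "S1 = (\<lambda>y. \<Sum>j. ennreal (2 powr a * (2 powr a) ^ j) * indicator (cball x (1 * (1/2) ^ j)) y)"
  define S2 where "S2 = (\<lambda>y. \<Sum>j. ennreal (1 * (2 powr - b) ^ j) * indicator (cball x (2 * 2 ^ j)) y)"
  \<comment> \<open>The series behind \<open>S1\<close> has ratio 2^(a-n), below 1 because a < n;
    the one behind \<open>S2\<close> has ratio 2^(n-b).\<close>
  have "2 powr a * (1 / 2) ^ ?n < 1"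
  proof -
    have "2 powr a < 2 powr real ?n"
      using a by simp
    then show ?thesis
      by (simp add: powr_realpow power_divide)
  qed
  then have S1: "(\<integral>\<^sup>+y. S1 y \<partial>lborel) < \<infinity>"
    unfolding S1_def by (intro nn_integral_dyadic_finite) auto
  have "2 powr - b * 2 ^ ?n < 1"
  proof -
    have "2 powr real ?n < 2 powr b"
      using b by simp
    then show ?thesis
      by (simp add: powr_realpow powr_minus field_simps)
  qed
  then have S2: "(\<integral>\<^sup>+y. S2 y \<partial>lborel) < \<infinity>"
    unfolding S2_def by (intro nn_integral_dyadic_finite) auto
  have S1_m: "S1 \<in> borel_measurable lborel"
    unfolding S1_def
    by (intro borel_measurable_suminf_order borel_measurable_times_ennreal borel_measurable_indicator) auto
  have S2_m: "S2 \<in> borel_measurable lborel"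
    unfolding S2_def
    by (intro borel_measurable_suminf_order borel_measurable_times_ennreal borel_measurable_indicator) auto
  have term_le: "f j \<le> suminf f" for f :: "nat \<Rightarrow> ennreal" and j
    using sum_le_suminf[of f "{j}"] by simp
  have le: "ennreal (norm (min (norm (x - y) powr - a) (norm (x - y) powr - b))) \<le> S1 y + S2 y" for y
  proof -
    define t where "t = norm (x - y)"
    consider "t = 0" | "0 < t" "t < 1" | "1 \<le> t"
      using norm_ge_zero[of "x - y"] unfolding t_def by linarith
    then show ?thesis
    proof cases
      \<comment> \<open>\<open>0 powr - a\<close> is 0 by convention, so the integrand vanishes at y
        = x.\<close>
      case 1
      then show ?thesis by (simp add: t_def)
    next
      case 2
      then obtain j where j: "2 ^ j \<le> 1 / t" "1 / t \<le> 2 ^ Suc j"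
        using ex_dyadic[of "1 / t"] by (auto simp: field_simps)
      have "t powr - a = (1 / t) powr a"
        using 2 by (simp add: powr_minus powr_divide divide_simps)
      also have "\<dots> \<le> (2 ^ Suc j) powr a"
        using j 2 a by (intro powr_mono2) auto
      also have "\<dots> = 2 powr a * (2 powr a) ^ j"
        by (simp add: powr_mult powr_powr mult.commute flip: powr_realpow)
      finally have "ennreal (t powr - a) \<le> ennreal (2 powr a * (2 powr a) ^ j) * indicator (cball x (1 * (1/2) ^ j)) y"
        using j 2 by (simp add: dist_norm t_def field_simps ennreal_leI)
      also have "\<dots> \<le> S1 y"
        unfolding S1_def by (rule term_le)
      finally have "ennreal (t powr - a) \<le> S1 y + S2 y"
        by (simp add: add_increasing2)
      moreover have "ennreal (norm (min (t powr - a) (t powr - b))) \<le> ennreal (t powr - a)"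
        by (intro ennreal_leI) auto
      ultimately show ?thesis
        unfolding t_def by order
    next
      case 3
      then obtain j where j: "2 ^ j \<le> t" "t \<le> 2 ^ Suc j"
        using ex_dyadic by blast
      have "t powr - b \<le> (2 ^ j) powr - b"
        using j b 3 by (intro powr_mono2') auto
      also have "\<dots> = 1 * (2 powr - b) ^ j"
        by (simp add: powr_powr mult.commute flip: powr_realpow)
      finally have "ennreal (t powr - b) \<le> ennreal (1 * (2 powr - b) ^ j) * indicator (cball x (2 * 2 ^ j)) y"
        using j by (simp add: dist_norm t_def ennreal_leI)
      also have "\<dots> \<le> S2 y"
        unfolding S2_def by (rule term_le)
      finally have "ennreal (t powr - b) \<le> S1 y + S2 y"
        by (simp add: add_increasing)
      moreover have "ennreal (norm (min (t powr - a) (t powr - b))) \<le> ennreal (t powr - b)"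
        by (intro ennreal_leI) auto
      ultimately show ?thesis
        unfolding t_def by order
    qed
  qed
  have "(\<integral>\<^sup>+y. ennreal (norm (min (norm (x - y) powr - a) (norm (x - y) powr - b))) \<partial>lborel)
      \<le> (\<integral>\<^sup>+y. S1 y + S2 y \<partial>lborel)"
    by (intro nn_integral_mono le)
  also have "\<dots> = (\<integral>\<^sup>+y. S1 y \<partial>lborel) + (\<integral>\<^sup>+y. S2 y \<partial>lborel)"
    using S1_m S2_m by (intro nn_integral_add)
  also have "\<dots> < \<infinity>"
    using S1 S2 by simp
  finally show "(\<integral>\<^sup>+y. ennreal (norm (min (norm (x - y) powr - a) (norm (x - y) powr - b))) \<partial>lborel) < \<infinity>" .
qed simp

section \<open>Mean value and Lipschitz estimates\<close>

text \<open>The segment from 0 to \<open>q\<close> meets the origin only at an endpoint, where the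
  mean value theorem asks for continuity alone. The bound is posed at rational parameters so that a
  countable family of almost-everywhere bounds can supply it.\<close>

lemma mean_value_through_origin:
  fixes G :: "'a::euclidean_space \<Rightarrow> real"
  assumes C1: "C1_on (UNIV - {0}) G" and cont: "continuous_on UNIV G" and q: "q \<noteq> 0"
    and le: "\<And>t. t \<in> \<rat> \<Longrightarrow> 0 < t \<Longrightarrow> t < 1 \<Longrightarrow> norm (grad G (t *\<^sub>R q)) \<le> L"
  shows "\<bar>G q - G 0\<bar> \<le> L * norm q"
proof -
  have "continuous_on (UNIV - {0}) (grad G)"
    using C1 by (simp add: C1_on_def)
  moreover have "continuous_on {0<..<1::real} (\<lambda>t. t *\<^sub>R q)"
    by (intro continuous_intros)
  moreover have "(\<lambda>t. t *\<^sub>R q) ` {0<..<1::real} \<subseteq> UNIV - {0}"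
    using q by auto
  ultimately have "continuous_on {0<..<1::real} (\<lambda>t. grad G (t *\<^sub>R q))"
    by (rule continuous_on_compose2)
  then have cont_norm: "continuous_on {0<..<1::real} (\<lambda>t. norm (grad G (t *\<^sub>R q)))"
    by (intro continuous_intros)
  have all: "norm (grad G (t *\<^sub>R q)) \<le> L" if t: "0 < t" "t < 1" for t :: real
  proof (rule ccontr)
    assume less: "\<not> ?thesis"
    \<comment> \<open>By continuity a violation at \<open>t\<close> persists on an open set of
      parameters, which must contain a rational.\<close>
    let ?U = "{0<..<1} \<inter> (\<lambda>t. norm (grad G (t *\<^sub>R q))) -` {L<..}"
    have "open ?U"
      by (rule continuous_open_preimage[OF cont_norm]) auto
    moreover have "t \<in> ?U"
      using t less by simp
    ultimately obtain e where e: "0 < e" "ball t e \<subseteq> ?U"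
      using open_contains_ball by metis
    obtain s where s: "s \<in> \<rat>" "t < s" "s < t + e"
      using Rats_dense_in_real[of t "t + e"] e(1) by force
    then have "s \<in> ?U"
      using e(2) by (intro subsetD[OF e(2)]) (simp add: dist_real_def)
    then show False
      using le[of s] s(1) by simp
  qed
  have deriv: "((\<lambda>t. G (t *\<^sub>R q)) has_derivative (\<lambda>s. s * inner q (grad G (t *\<^sub>R q)))) (at t)"
    if "0 < t" for t :: real
  proof -
    have "G differentiable (at (t *\<^sub>R q))"
      using C1 q that by (simp add: C1_on_def)
    then have *: "(G has_derivative (\<lambda>h. inner h (grad G (t *\<^sub>R q)))) (at (t *\<^sub>R q))"
      using GDERIV_grad by (simp add: gderiv_def)
    have "((\<lambda>t::real. t *\<^sub>R q) has_derivative (\<lambda>s. s *\<^sub>R q)) (at t)"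
      by (auto intro!: derivative_eq_intros)
    from has_derivative_compose[OF this *] show ?thesis
      by simp
  qed
  have cont01: "continuous_on {0..1::real} (\<lambda>t. G (t *\<^sub>R q))"
    by (rule continuous_on_compose2[OF cont]) (auto intro!: continuous_intros)
  obtain t :: real where t: "0 < t" "t < 1"
    and eq: "G (1 *\<^sub>R q) - G (0 *\<^sub>R q) = (1 - 0) * inner q (grad G (t *\<^sub>R q))"
    by (rule mvt[OF zero_less_one cont01 deriv])
  have "\<bar>G q - G 0\<bar> \<le> norm q * norm (grad G (t *\<^sub>R q))"
    using eq Cauchy_Schwarz_ineq2[of q "grad G (t *\<^sub>R q)"] by simp
  also have "\<dots> \<le> norm q * L"
    using all[OF t] by (intro mult_left_mono) auto
  finally show ?thesis
    by (simp add: mult.commute)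
qed

text \<open>After multiplication by \<open>r ^ m\<close> the powers have bases r/a and r/b in [0,1],
  where the m-th power is Lipschitz with constant m.\<close>

lemma abs_inverse_power_diff_le:
  fixes a b r :: real
  assumes "0 < r" "r \<le> a" "r \<le> b"
  shows "\<bar>1 / a ^ m - 1 / b ^ m\<bar> \<le> real m / r ^ Suc m * \<bar>a - b\<bar>"
proof -
  have pos: "0 < a" "0 < b"
    using assms by linarith+
  have "r ^ m * \<bar>1 / a ^ m - 1 / b ^ m\<bar> = norm ((r / a) ^ m - (r / b) ^ m)"
  proof -
    have "norm ((r / a) ^ m - (r / b) ^ m) = \<bar>r ^ m * (1 / a ^ m - 1 / b ^ m)\<bar>"
      by (simp add: power_divide right_diff_distrib)
    then show ?thesis
      using assms(1) by (simp add: abs_mult)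
  qed
  also have "\<dots> \<le> real m * norm (r / a - r / b)"
    using assms pos by (intro norm_power_diff) auto
  also have "norm (r / a - r / b) = r * \<bar>a - b\<bar> / (a * b)"
    proof -
    have "r / a - r / b = r * (b - a) / (a * b)"
      using pos by (simp add: field_simps)
    then show ?thesis
      using pos assms(1) by (simp add: abs_mult abs_minus_commute)
  qed
  also have "\<dots> \<le> r * \<bar>a - b\<bar> / (r * r)"
    using assms by (intro divide_left_mono mult_mono mult_pos_pos) auto
  also have "\<dots> = \<bar>a - b\<bar> / r"
    using assms by simp
  finally have "r ^ m * \<bar>1 / a ^ m - 1 / b ^ m\<bar> \<le> real m * (\<bar>a - b\<bar> / r)"
    by (simp add: mult_left_mono)
  then show ?thesis
    using assms(1) by (simp add: field_simps)
qed

section \<open>Measurability and the weighted norms\<close>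

lemma newton_kernel_measurable:
  fixes x :: "'a::euclidean_space"
  shows "(\<lambda>y. 1 / norm (x - y) ^ m) \<in> borel_measurable lebesgue"
  by (intro measurable_completion) simp

lemma norm_weight_measurable:
  "(\<lambda>x::'a::euclidean_space. (1 + norm x) powr m) \<in> borel_measurable lebesgue"
  by (intro measurable_completion) simp

lemma E_norm_leI:
  assumes "f \<in> borel_measurable lebesgue"
    and "AE x in lebesgue. (1 + norm x) powr m * norm (f x) \<le> B"
  shows "E_norm m f \<le> ennreal B"
proof -
  have "(\<lambda>x. ennreal ((1 + norm x) powr m * norm (f x))) \<in> borel_measurable lebesgue"
    using measurable_compose[OF assms(1) borel_measurable_norm]
    by (intro measurable_compose[OF _ measurable_ennreal] borel_measurable_times norm_weight_measurable)
       simp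
  then show ?thesis
    using assms unfolding E_norm_on_def lebesgue_on_UNIV_eq
    by (auto intro!: esssup_I elim!: eventually_mono ennreal_leI)
qed

text \<open>A finite bound rules out the default value \<open>\<infinity>\<close>, hence the
  measurability. The essential supremum bounds the function almost everywhere on \<open>S\<close>,
  and measurability of \<open>S\<close> carries this over to the whole space.\<close>

lemma E_norm_leD:
  assumes "E_norm_on S m f \<le> ennreal B" "0 \<le> B" "S \<in> sets lebesgue"
  shows "f \<in> borel_measurable (lebesgue_on S)"
    and "AE x in lebesgue. x \<in> S \<longrightarrow> (1 + norm x) powr m * norm (f x) \<le> B"
proof -
  show meas: "f \<in> borel_measurable (lebesgue_on S)"
    using assms(1) by (auto simp: E_norm_on_def top_unique split: if_splits)
  then have "E_norm_on S m f = esssup (lebesgue_on S) (\<lambda>x. ennreal ((1 + norm x) powr m * norm (f x)))"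
    by (simp add: E_norm_on_def)
  then have "AE x in lebesgue_on S. ennreal ((1 + norm x) powr m * norm (f x)) \<le> E_norm_on S m f"
    using esssup_AE[where M = "lebesgue_on S" and f = "\<lambda>x. ennreal ((1 + norm x) powr m * norm (f x))"]
    by simp
  then have "AE x in lebesgue_on S. (1 + norm x) powr m * norm (f x) \<le> B"
  proof eventually_elim
    case (elim x)
    then have "ennreal ((1 + norm x) powr m * norm (f x)) \<le> ennreal B"
      using assms(1) by order
    then show ?case
      using assms(2) by (simp add: ennreal_le_iff)
  qed
  then show "AE x in lebesgue. x \<in> S \<longrightarrow> (1 + norm x) powr m * norm (f x) \<le> B"
    using assms(3) by (subst (asm) AE_restrict_space_iff) auto
qed

lemma E_spaceE:
  fixes f :: "real^'n \<Rightarrow> 'b::real_normed_vector"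
  assumes "f \<in> E_space m"
  obtains B where "0 \<le> B" "f \<in> borel_measurable lebesgue"
    "AE x in lebesgue. (1 + norm x) powr m * norm (f x) \<le> B"
proof -
  define B where "B = enn2real (E_norm m f)"
  have "E_norm m f \<le> ennreal B"
    using assms by (simp add: B_def E_space_def)
  from E_norm_leD[OF this] show ?thesis
    by (intro that[of B]) (auto simp: B_def lebesgue_on_UNIV_eq)
qed

lemma F_norm_le_iff:
  "0 \<le> B \<Longrightarrow> F_norm m u \<le> ennreal B \<longleftrightarrow> (\<forall>x. (1 + norm x) powr m * (\<bar>u x\<bar> + norm (grad u x)) \<le> B)"
  by (simp add: F_norm_def SUP_le_iff ennreal_le_iff)

section \<open>Convergence and additivity of the Newtonian potential\<close>

text \<open>Put t = |x - y| and let n be the dimension. The density is bounded by a constant and,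
  since t \<le> (1 + |x|)(1 + |y|), also by a multiple of t^-(k+2). The kernel t^(2-n) turns this
  into the decay exponents n-2 < n and n+k > n, which give an integrable minimum.\<close>

lemma newton_kernel_integrable:
  fixes f :: "real^'n \<Rightarrow> real"
  assumes n: "CARD('n) \<ge> 3" and k: "0 < k" and f: "f \<in> E_space (k + 2)"
  shows "integrable lebesgue (\<lambda>y. 1 / norm (x - y) ^ (CARD('n) - 2) * f y)"
proof -
  obtain B where B: "0 \<le> B" "AE x in lebesgue. (1 + norm x) powr (k + 2) * norm (f x) \<le> B"
    and meas: "f \<in> borel_measurable lebesgue"
    using E_spaceE[OF f] by blast
  define m where "m = CARD('n) - 2"
  have m: "real CARD('n) = real m + 2" "0 < m"
    using n by (auto simp: m_def)
  \<comment> \<open>The factor (1 + |x|)^(k+2) serves the bound by t^-(k+2); being at least 1, it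
    lets the same \<open>c\<close> serve as the plain bound on |f|.\<close>
  define c where "c = B * (1 + norm x) powr (k + 2)"
  have "0 \<le> c"
    using B(1) by (simp add: c_def)
  let ?h = "\<lambda>y. min (norm (x - y) powr - real m) (norm (x - y) powr - (real m + (k + 2)))"
  have "integrable lborel ?h"
    using m k by (intro integrable_min_norm_powr) auto
  then have "integrable lebesgue (\<lambda>y. c * ?h y)"
    by (intro integrable_mult_right) (simp add: integrable_completion)
  then show ?thesis
  proof (rule Bochner_Integration.integrable_bound)
    show "(\<lambda>y. 1 / norm (x - y) ^ (CARD('n) - 2) * f y) \<in> borel_measurable lebesgue"
      using meas by (intro borel_measurable_times newton_kernel_measurable)
    show "AE y in lebesgue. norm (1 / norm (x - y) ^ (CARD('n) - 2) * f y) \<le> norm (c * ?h y)"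
      using B(2)
    proof eventually_elim
      case (elim y)
      define t where "t = norm (x - y)"
      show ?case
      proof (cases "t = 0")
        \<comment> \<open>At y = x the kernel is 1 / 0 = 0, because the exponent \<open>m\<close> is
          positive.\<close>
        case True
        then show ?thesis
          using m(2) by (simp add: t_def m_def zero_power)
      next
        case False
        then have t: "0 < t"
          by (simp add: t_def)
        have "t \<le> norm x + norm y"
          by (simp add: t_def norm_triangle_ineq4)
        also have "\<dots> \<le> (1 + norm x) * (1 + norm y)"
          by (simp add: algebra_simps)
        finally have "t powr (k + 2) \<le> ((1 + norm x) * (1 + norm y)) powr (k + 2)"
          using t k by (intro powr_mono2) auto
        then have "t powr (k + 2) * \<bar>f y\<bar> \<le> (1 + norm x) powr (k + 2) * ((1 + norm y) powr (k + 2) * \<bar>f y\<bar>)"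
          by (simp add: powr_mult mult_right_mono flip: mult.assoc)
        also have "\<dots> \<le> c"
          unfolding c_def using elim by (subst mult.commute) (simp add: mult_right_mono)
        finally have far: "\<bar>f y\<bar> \<le> c * t powr - (k + 2)"
          using t powr_minus[of t "k + 2"]
          by (simp add: pos_le_divide_eq mult.commute flip: divide_inverse)
        have "1 * \<bar>f y\<bar> \<le> (1 + norm y) powr (k + 2) * \<bar>f y\<bar>"
          using k by (intro mult_right_mono ge_one_powr_ge_zero) auto
        also have "\<dots> \<le> B * 1"
          using elim by simp
        also have "\<dots> \<le> c"
          unfolding c_def using B(1) k by (intro mult_left_mono ge_one_powr_ge_zero) auto
        finally have near: "\<bar>f y\<bar> \<le> c"
          by simp
        have "1 / t ^ m * \<bar>f y\<bar> = t powr - real m * \<bar>f y\<bar>"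
          using t by (simp add: powr_minus powr_realpow field_simps)
        moreover have "t powr - real m * \<bar>f y\<bar> \<le> c * t powr - real m"
          using near by (subst mult.commute) (simp add: mult_right_mono)
        moreover have "t powr - real m * \<bar>f y\<bar> \<le> c * t powr - (real m + (k + 2))"
        proof -
          have "t powr - real m * \<bar>f y\<bar> \<le> t powr - real m * (c * t powr - (k + 2))"
            using far by (intro mult_left_mono) auto
          also have "\<dots> = c * (t powr - real m * t powr - (k + 2))"
            by simp
          also have "\<dots> = c * t powr - (real m + (k + 2))"
            unfolding powr_add[symmetric] by simp
          finally show ?thesis .
        qed
        ultimately have "1 / t ^ m * \<bar>f y\<bar> \<le> c * min (t powr - real m) (t powr - (real m + (k + 2)))"
          by (metis min_def)
        then show ?thesis
          using \<open>0 \<le> c\<close> by (simp add: t_def m_def abs_mult)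
      qed
    qed
  qed
qed

lemma newton_potential_add:
  fixes f g :: "real^'n \<Rightarrow> real"
  assumes "CARD('n) \<ge> 3" "0 < k" "f \<in> E_space (k + 2)" "g \<in> E_space (k + 2)"
  shows "newton_potential (\<lambda>y. f y + g y) x = newton_potential f x + newton_potential g x"
  unfolding newton_potential_def
  using newton_kernel_integrable[OF assms(1,2,3), of x] newton_kernel_integrable[OF assms(1,2,4), of x]
  by (simp add: distrib_left)

section \<open>Decay of the potential of a compactly supported density\<close>

text \<open>Far from the support the kernel is of order |x|^(2-n) and its Lipschitz constant in x of
  order |x|^(1-n). So value and gradient decay at least like |x|^(2-n), which beats the weight as k
  < n-2. With differentiability given by \<open>diff\<close>, the gradient bound is read off a
  Lipschitz bound.\<close>

lemma tendsto_weighted_compact_potential: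
  fixes f :: "real^'n \<Rightarrow> real"
  assumes n: "CARD('n) \<ge> 3" and k: "0 < k" "k < real CARD('n) - 2"
    and int: "integrable lebesgue f" and R: "0 \<le> R" and supp: "\<And>y. R < norm y \<Longrightarrow> f y = 0"
    and diff: "\<And>x. newton_potential f differentiable (at x)"
  shows "((\<lambda>x. (1 + norm x) powr k * (\<bar>newton_potential f x\<bar> + norm (grad (newton_potential f) x)))
           \<longlongrightarrow> 0) at_infinity"
proof -
  define m where "m = CARD('n) - 2"
  have m: "k < real m"
    using n k by (simp add: m_def)
  define c where "c = 1 / ((real CARD('n) - 2) * unit_sphere_area CARD('n))"
  define K where "K = (\<lambda>x y::real^'n. 1 / norm (x - y) ^ m * f y)"
  have N: "newton_potential f x = c * (LINT y|lebesgue. K x y)" for x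
    by (simp add: newton_potential_def c_def K_def m_def)
  define J where "J = (LINT y|lebesgue. \<bar>f y\<bar>)"
  have J: "0 \<le> J"
    by (simp add: J_def)
  have meas: "K x \<in> borel_measurable lebesgue" for x
    unfolding K_def using int by (intro borel_measurable_times newton_kernel_measurable) auto
  \<comment> \<open>Here and below, \<open>r\<close> is a lower bound for the distance from
    \<open>x\<close> to the ball that carries \<open>f\<close>.\<close>
  have K_le: "\<bar>K x y\<bar> \<le> 1 / r ^ m * \<bar>f y\<bar>" if "0 < r" "\<And>y. norm y \<le> R \<Longrightarrow> r \<le> norm (x - y)" for x y r
  proof (cases "norm y \<le> R")
    case True
    then have "1 / norm (x - y) ^ m \<le> 1 / r ^ m"
      using that(1) that(2)[OF True]
      by (intro divide_left_mono power_mono mult_pos_pos zero_less_power) linarith+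
    then have "1 / norm (x - y) ^ m * \<bar>f y\<bar> \<le> 1 / r ^ m * \<bar>f y\<bar>"
      by (rule mult_right_mono) simp
    then show ?thesis
      by (simp add: K_def abs_mult)
  qed (use supp in \<open>simp add: K_def\<close>)
  have K_int: "integrable lebesgue (K x)" if "0 < r" "\<And>y. norm y \<le> R \<Longrightarrow> r \<le> norm (x - y)" for x r
    by (rule Bochner_Integration.integrable_bound[where f = "\<lambda>y. 1 / r ^ m * \<bar>f y\<bar>"])
       (use int meas K_le[OF that] that(1) in \<open>auto intro!: AE_I2\<close>)
  have size: "\<bar>newton_potential f x\<bar> \<le> \<bar>c\<bar> * J / r ^ m"
    if "0 < r" "\<And>y. norm y \<le> R \<Longrightarrow> r \<le> norm (x - y)" for x r
  proof -
    have "\<bar>LINT y|lebesgue. K x y\<bar> \<le> (LINT y|lebesgue. \<bar>K x y\<bar>)"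
      by (rule integral_abs_bound)
    also have "\<dots> \<le> (LINT y|lebesgue. 1 / r ^ m * \<bar>f y\<bar>)"
      using K_int[OF that] int K_le[OF that] by (intro integral_mono) auto
    also have "\<dots> = J / r ^ m"
      by (simp add: J_def)
    finally have "\<bar>LINT y|lebesgue. K x y\<bar> \<le> J / r ^ m" .
    from mult_left_mono[OF this, of "\<bar>c\<bar>"] show ?thesis
      by (simp add: N abs_mult)
  qed
  \<comment> \<open>One \<open>r\<close> serves both points, so the kernel difference yields a
    Lipschitz constant of order r^-(m+1).\<close>
  have lip: "\<bar>newton_potential f x' - newton_potential f x\<bar> \<le> \<bar>c\<bar> * (real m * J / r ^ Suc m) * norm (x' - x)"
    if r: "0 < r" and x: "\<And>y. norm y \<le> R \<Longrightarrow> r \<le> norm (x - y)" and x': "\<And>y. norm y \<le> R \<Longrightarrow> r \<le> norm (x' - y)"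
    for x x' r
  proof -
    let ?L = "real m / r ^ Suc m * norm (x' - x)"
    have pt: "\<bar>K x' y - K x y\<bar> \<le> ?L * \<bar>f y\<bar>" for y
    proof (cases "norm y \<le> R")
      case True
      have "\<bar>1 / norm (x' - y) ^ m - 1 / norm (x - y) ^ m\<bar>
          \<le> real m / r ^ Suc m * \<bar>norm (x' - y) - norm (x - y)\<bar>"
        using r x'[OF True] x[OF True] by (rule abs_inverse_power_diff_le)
      also have "\<dots> \<le> ?L"
        using r norm_triangle_ineq3[of "x' - y" "x - y"] by (intro mult_left_mono) auto
      finally have "\<bar>1 / norm (x' - y) ^ m - 1 / norm (x - y) ^ m\<bar> * \<bar>f y\<bar> \<le> ?L * \<bar>f y\<bar>"
        by (intro mult_right_mono) auto
      then show ?thesis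
        unfolding K_def by (simp only: abs_mult[symmetric] left_diff_distrib)
    qed (use supp in \<open>simp add: K_def\<close>)
    have "\<bar>LINT y|lebesgue. K x' y - K x y\<bar> \<le> (LINT y|lebesgue. \<bar>K x' y - K x y\<bar>)"
      by (rule integral_abs_bound)
    also have "\<dots> \<le> (LINT y|lebesgue. ?L * \<bar>f y\<bar>)"
      using K_int[OF r x] K_int[OF r x'] int pt by (intro integral_mono) auto
    also have "\<dots> = ?L * J"
      by (simp only: J_def integral_mult_right_zero)
    finally have "\<bar>(LINT y|lebesgue. K x' y) - (LINT y|lebesgue. K x y)\<bar> \<le> ?L * J"
      using K_int[OF r x] K_int[OF r x'] by simp
    from mult_left_mono[OF this, of "\<bar>c\<bar>"] show ?thesis
      by (simp add: N abs_mult[symmetric] right_diff_distrib[symmetric] mult_ac)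
  qed
  \<comment> \<open>The factor \<open>2 ^ m\<close> comes from r = |x|/2 and \<open>2 powr k\<close>
    from 1 + |x| \<le> 2 |x|.\<close>
  define A where "A = \<bar>c\<bar> * J * (1 + real m) * 2 ^ m * 2 powr k"
  have A: "0 \<le> A"
    using J by (simp add: A_def)
  have bound: "(1 + norm x) powr k * (\<bar>newton_potential f x\<bar> + norm (grad (newton_potential f) x))
      \<le> A * norm x powr (k - real m)"
    if x: "4 * (R + 1) \<le> norm x" for x
  proof -
    \<comment> \<open>From |x| = 4 (R + 1) on, every point within distance 1 of \<open>x\<close>
      stays at distance at least \<open>r\<close> from the ball of radius \<open>R\<close>, and r
      \<ge> 1.\<close>
    define r where "r = norm x / 2"
    have r: "1 \<le> r"
      using x R by (simp add: r_def)
    have far: "r \<le> norm (x' - y)" if "x' \<in> ball x 1" "norm y \<le> R" for x' y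
    proof -
      have "norm x \<le> norm (x' - y) + norm y + dist x x'"
        using norm_triangle_ineq[of "x' - y" y] norm_triangle_ineq[of x' "x - x'"]
        by (simp add: dist_norm)
      then show ?thesis
        using that x R by (simp add: r_def)
    qed
    have xx: "x \<in> ball x 1" by simp
    have v: "\<bar>newton_potential f x\<bar> \<le> \<bar>c\<bar> * J / r ^ m"
      by (rule size) (use r far[OF xx] in auto)
    have "norm (grad (newton_potential f) x) \<le> \<bar>c\<bar> * (real m * J / r ^ Suc m)"
    proof (rule norm_grad_le_local_Lipschitz[where r = 1])
      show "\<bar>newton_potential f y - newton_potential f x\<bar> \<le> \<bar>c\<bar> * (real m * J / r ^ Suc m) * norm (y - x)"
        if "y \<in> ball x 1" for y
        by (rule lip) (use r far[OF xx] far[OF that] in auto)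
    qed (use diff J r in auto)
    \<comment> \<open>Since r \<ge> 1, the gradient bound can be relaxed to the same power as the
      bound on the value.\<close>
    also have "\<dots> \<le> \<bar>c\<bar> * (real m * J / r ^ m)"
      using r J by (intro mult_left_mono divide_left_mono mult_nonneg_nonneg mult_pos_pos power_increasing) auto
    finally have "\<bar>newton_potential f x\<bar> + norm (grad (newton_potential f) x)
        \<le> \<bar>c\<bar> * J * (1 + real m) / r ^ m"
      using v by (simp add: algebra_simps add_divide_distrib)
    also have "\<dots> = \<bar>c\<bar> * J * (1 + real m) * 2 ^ m * norm x powr - real m"
    proof -
      have "0 < norm x"
        using r unfolding r_def by linarith
      then have "norm x powr real m = norm x ^ m"
        by (rule powr_realpow)
      then show ?thesis
        by (simp add: r_def power_divide powr_minus_divide)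
    qed
    finally have 1: "\<bar>newton_potential f x\<bar> + norm (grad (newton_potential f) x)
        \<le> \<bar>c\<bar> * J * (1 + real m) * 2 ^ m * norm x powr - real m" .
    have "(1 + norm x) powr k \<le> (2 * norm x) powr k"
      using x R k by (intro powr_mono2) auto
    then have 2: "(1 + norm x) powr k \<le> 2 powr k * norm x powr k"
      by (simp add: powr_mult)
    have "(1 + norm x) powr k * (\<bar>newton_potential f x\<bar> + norm (grad (newton_potential f) x))
        \<le> (2 powr k * norm x powr k) * (\<bar>c\<bar> * J * (1 + real m) * 2 ^ m * norm x powr - real m)"
      using 1 2 by (intro mult_mono) auto
    also have "\<dots> = A * (norm x powr k * norm x powr - real m)"
      by (simp add: A_def)
    also have "\<dots> = A * norm x powr (k - real m)"
      by (simp flip: powr_add)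
    finally show ?thesis .
  qed
  have "((\<lambda>x::real^'n. A * norm x powr (k - real m)) \<longlongrightarrow> A * 0) at_infinity"
    using m by (intro tendsto_mult_left tendsto_neg_powr filterlim_norm_at_top) auto
  then have lim: "((\<lambda>x::real^'n. A * norm x powr (k - real m)) \<longlongrightarrow> 0) at_infinity"
    by simp
  show ?thesis
  proof (rule tendsto_sandwich[OF _ _ tendsto_const lim])
    show "\<forall>\<^sub>F x in at_infinity. (1 + norm x) powr k * (\<bar>newton_potential f x\<bar> + norm (grad (newton_potential f) x))
        \<le> A * norm x powr (k - real m)"
      unfolding eventually_at_infinity using bound by blast
  qed auto
qed

section \<open>Scaling in the solution space and the increment of the nonlinearity\<close>

lemma F_spaceD:
  fixes u :: "real^'n \<Rightarrow> real"
  assumes "u \<in> F_space k"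
  shows "u differentiable (at x)" "continuous_on UNIV u" "continuous_on UNIV (grad u)" "F_norm k u < \<infinity>"
proof -
  show diff: "u differentiable (at x)" for x
    using assms by (simp add: F_space_def C1_on_def)
  then show "continuous_on UNIV u"
    by (simp add: continuous_on_eq_continuous_within differentiable_imp_continuous_within)
qed (use assms in \<open>simp_all add: F_space_def C1_on_def\<close>)

lemma grad_scale:
  fixes u :: "'a::euclidean_space \<Rightarrow> real"
  assumes "u differentiable (at x)"
  shows "grad (\<lambda>x. t * u x) x = t *\<^sub>R grad u x"
proof (rule grad_eq)
  show "GDERIV (\<lambda>x. t * u x) x :> t *\<^sub>R grad u x"
    using has_derivative_mult_right[OF GDERIV_grad[OF assms, unfolded gderiv_def], of t]
    by (simp add: gderiv_def)
qed

text \<open>This keeps the multiples \<open>t * u\<close> of the solution within the norm bound of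
  the supremum \<open>D_zp_sup\<close>.\<close>

lemma scale_in_F_space:
  fixes u :: "real^'n \<Rightarrow> real"
  assumes u: "u \<in> F_space k" and t: "0 \<le> t" "t \<le> 1"
  shows "(\<lambda>x. t * u x) \<in> F_space k" "F_norm k (\<lambda>x. t * u x) \<le> F_norm k u"
proof -
  note grad_t = grad_scale[OF F_spaceD(1)[OF u]]
  show le: "F_norm k (\<lambda>x. t * u x) \<le> F_norm k u"
    unfolding F_norm_def
  proof (intro SUP_mono' ennreal_leI mult_left_mono)
    fix x
    have "\<bar>t * u x\<bar> + norm (grad (\<lambda>x. t * u x) x) = t * (\<bar>u x\<bar> + norm (grad u x))"
      using t by (simp add: grad_t abs_mult distrib_left)
    also have "\<dots> \<le> \<bar>u x\<bar> + norm (grad u x)"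
      using t by (intro mult_left_le_one_le) auto
    finally show "\<bar>t * u x\<bar> + norm (grad (\<lambda>x. t * u x) x) \<le> \<bar>u x\<bar> + norm (grad u x)" .
  qed auto
  have "C1_on UNIV (\<lambda>x. t * u x)"
    unfolding C1_on_def
  proof (intro conjI ballI)
    show "(\<lambda>x. t * u x) differentiable (at x)" for x
      using F_spaceD(1)[OF u] by (intro differentiable_mult differentiable_const)
    have "continuous_on UNIV (\<lambda>x. t *\<^sub>R grad u x)"
      using F_spaceD(3)[OF u] by (intro continuous_intros)
    moreover have "grad (\<lambda>x. t * u x) = (\<lambda>x. t *\<^sub>R grad u x)"
      by (rule ext) (rule grad_t)
    ultimately show "continuous_on UNIV (grad (\<lambda>x. t * u x))"
      by simp
  qed
  moreover have "F_norm k (\<lambda>x. t * u x) < \<infinity>"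
    using le F_spaceD(4)[OF u] by order
  ultimately show "(\<lambda>x. t * u x) \<in> F_space k"
    by (simp add: F_space_def)
qed

text \<open>Testing the supremum with w = t u bounds \<open>D_zp g\<close> at the points t (u(x),
  Du(x)), as the mean value estimate on the segment requires. Off \<open>S\<close> both sides are
  zero.\<close>

lemma AE_nonlinearity_increment:
  fixes g :: "real^'n \<Rightarrow> real \<Rightarrow> real^'n \<Rightarrow> real" and u :: "real^'n \<Rightarrow> real"
  assumes C1: "\<And>x. C1_on (UNIV - {(0, 0)}) (\<lambda>(z, p). g x z p)"
    and cont: "\<And>x. continuous_on UNIV (\<lambda>(z, p). g x z p)"
    and u: "u \<in> F_space k" "F_norm k u \<le> ennreal \<epsilon>"
    and M: "D_zp_sup k g \<epsilon> \<le> ennreal M" "0 \<le> M"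
  shows "AE x in lebesgue. \<bar>g x (u x) (grad u x) - g x 0 0\<bar>
           \<le> M * (1 + norm x) powr - 2 * (\<bar>u x\<bar> + norm (grad u x))"
proof -
  define S where "S = {x. (u x, grad u x) \<noteq> (0, 0)}"
  note grad_t = grad_scale[OF F_spaceD(1)[OF u(1)]]
  \<comment> \<open>\<open>S\<close> is open because \<open>u\<close> and its gradient are
    continuous; its measurability turns the norm over \<open>S\<close> into an almost-everywhere
    statement.\<close>
  have "S = - (u -` {0} \<inter> grad u -` {0})"
    by (auto simp: S_def)
  moreover have "closed (u -` {0})" "closed (grad u -` {0})"
    using F_spaceD(2,3)[OF u(1)] by (auto intro!: closed_vimage)
  ultimately have S: "S \<in> sets lebesgue"
    by (simp add: closed_Int lborelD open_Compl)
  \<comment> \<open>The exceptional null set depends on \<open>t\<close>, so only countably many \<open>t\<close> are admissible at once;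
    the rational ones suffice since \<open>D\<^bsub>(z,p)\<^esub>g\<close> is continuous off the origin.\<close>
  have AE_t: "AE x in lebesgue. x \<in> S \<longrightarrow>
      (1 + norm x) powr 2 * norm (D_zp g x (t * u x) (t *\<^sub>R grad u x)) \<le> M"
    if t: "0 < t" "t \<le> 1" for t
  \<comment> \<open>If \<open>S\<close> is empty then u = 0 and the supremum does not admit t u, but
    the claim is vacuous.\<close>
  proof (cases "S = {}")
    case False
    then obtain x where x: "(u x, grad u x) \<noteq> (0, 0)"
      by (auto simp: S_def)
    define w where "w = (\<lambda>x. t * u x)"
    have grad_w: "grad w x = t *\<^sub>R grad u x" for x
      unfolding w_def by (rule grad_t)
    have w_eq: "w x = t * u x" for x
      by (simp add: w_def)
    have w: "w \<in> F_space k" "F_norm k w \<le> ennreal \<epsilon>"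
      using scale_in_F_space[OF u(1), of t] t u(2) unfolding w_def by (auto intro: order_trans)
    \<comment> \<open>The supremum admits only functions of positive norm; the chosen point of
      \<open>S\<close> provides this.\<close>
    have "0 < \<bar>w x\<bar> + norm (grad w x)"
    proof -
      have "\<bar>w x\<bar> + norm (grad w x) = t * (\<bar>u x\<bar> + norm (grad u x))"
        using t by (simp add: w_eq grad_w abs_mult distrib_left)
      moreover have "0 < \<bar>u x\<bar> + norm (grad u x)"
        using x by (auto intro: add_pos_nonneg add_nonneg_pos)
      ultimately show ?thesis
        using t by simp
    qed
    then have "0 < ennreal ((1 + norm x) powr k * (\<bar>w x\<bar> + norm (grad w x)))"
      using add_pos_nonneg[OF zero_less_one norm_ge_zero[of x]] by simp
    also have "\<dots> \<le> F_norm k w"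
      unfolding F_norm_def by (rule SUP_upper) simp
    finally have "0 < F_norm k w" .
    then have "E_norm_on {x. (w x, grad w x) \<noteq> (0, 0)} 2 (\<lambda>x. D_zp g x (w x) (grad w x)) \<le> D_zp_sup k g \<epsilon>"
      unfolding D_zp_sup_def using w by (intro SUP_upper) auto
    \<comment> \<open>As t > 0, all the multiples of \<open>u\<close> share one nonvanishing set, so
      the bounds for different \<open>t\<close> live on the same \<open>S\<close>.\<close>
    moreover have "{x. (w x, grad w x) \<noteq> (0, 0)} = S"
      using t by (simp add: S_def w_eq grad_w)
    ultimately have "E_norm_on S 2 (\<lambda>x. D_zp g x (w x) (grad w x)) \<le> ennreal M"
      using M(1) by simp
    from E_norm_leD(2)[OF this M(2) S] show ?thesis
      by (simp only: w_eq grad_w)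
  qed simp
  have "AE x in lebesgue. \<forall>t\<in>\<rat> \<inter> {0<..1}. x \<in> S \<longrightarrow>
      (1 + norm x) powr 2 * norm (D_zp g x (t * u x) (t *\<^sub>R grad u x)) \<le> M"
    using AE_t by (subst AE_ball_countable) (auto simp: countable_rat)
  then show ?thesis
  proof eventually_elim
    case (elim x)
    define q where "q = (u x, grad u x)"
    show ?case
    proof (cases "x \<in> S")
      case False
      then show ?thesis
        by (simp add: S_def)
    next
      case True
      then have q: "q \<noteq> 0"
        by (auto simp: S_def q_def zero_prod_def)
      have pos: "0 < 1 + norm x"
        by (simp add: add_pos_nonneg)
      have "\<bar>(\<lambda>(z, p). g x z p) q - (\<lambda>(z, p). g x z p) 0\<bar> \<le> M * (1 + norm x) powr - 2 * norm q"
      proof (rule mean_value_through_origin)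
        show "C1_on (UNIV - {0}) (\<lambda>(z, p). g x z p)"
          using C1[of x] by (simp add: zero_prod_def)
        show "norm (grad (\<lambda>(z, p). g x z p) (t *\<^sub>R q)) \<le> M * (1 + norm x) powr - 2"
          if "t \<in> \<rat>" "0 < t" "t < 1" for t
        proof -
          have "(1 + norm x) powr 2 * norm (D_zp g x (t * u x) (t *\<^sub>R grad u x)) \<le> M"
            using elim that True by auto
          then have "norm (D_zp g x (t * u x) (t *\<^sub>R grad u x)) \<le> M * (1 + norm x) powr - 2"
            using pos by (simp add: powr_minus field_simps)
          then show ?thesis
            by (simp add: D_zp_def q_def)
        qed
      qed (use cont q in auto)
      also have "norm q \<le> \<bar>u x\<bar> + norm (grad u x)"
        using norm_Pair_le[of "u x" "grad u x"] by (simp add: q_def)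
      finally show ?thesis
        using M(2) by (simp add: q_def zero_prod_def mult_left_mono)
    qed
  qed
qed

section \<open>Non-measurable densities\<close>

text \<open>The kernel is measurable and nonzero off y = x, so dividing an integrable integrand by
  it would show \<open>f\<close> to be measurable.\<close>

lemma newton_potential_non_measurable:
  fixes f :: "real^'n \<Rightarrow> real"
  assumes "f \<notin> borel_measurable lebesgue"
  shows "newton_potential f x = 0"
proof -
  define K where "K = (\<lambda>y::real^'n. 1 / norm (x - y) ^ (CARD('n) - 2))"
  have "\<not> integrable lebesgue (\<lambda>y. K y * f y)"
  proof
    assume "integrable lebesgue (\<lambda>y. K y * f y)"
    then have "(\<lambda>y. K y * f y) \<in> borel_measurable lebesgue"
      by (rule borel_measurable_integrable)
    then have "(\<lambda>y. (K y * f y) / K y) \<in> borel_measurable lebesgue"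
      unfolding K_def by (intro borel_measurable_divide newton_kernel_measurable)
    \<comment> \<open>At y = x the division convention can make the kernel 0, so the quotient is
      corrected at this one point.\<close>
    then have "(\<lambda>y. if y \<in> {x} then f x else (K y * f y) / K y) \<in> borel_measurable lebesgue"
      by (intro measurable_If_set) auto
    moreover have "(\<lambda>y. if y \<in> {x} then f x else (K y * f y) / K y) = f"
      by (auto simp: K_def)
    ultimately have "f \<in> borel_measurable lebesgue"
      by simp
    then show False
      using assms by simp
  qed
  then show ?thesis
    by (simp add: newton_potential_def K_def not_integrable_integral_eq)
qed

section \<open>The contraction argument\<close>

text \<open>The upper limit L of \<open>\<phi>\<close> satisfies L \<le> L/2, hence L = 0. The proof
  replaces the upper limit by finitely many halvings that start from the global bound
  \<open>B\<close>.\<close>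

lemma tendsto_0_of_contraction:
  fixes \<phi> :: "'a \<Rightarrow> real"
  assumes nonneg: "\<And>x. 0 \<le> \<phi> x" and bdd: "\<And>x. \<phi> x \<le> B"
    and step: "\<And>b e. 0 \<le> b \<Longrightarrow> 0 < e \<Longrightarrow> eventually (\<lambda>x. \<phi> x \<le> b) F \<Longrightarrow> eventually (\<lambda>x. \<phi> x \<le> b / 2 + e) F"
  shows "(\<phi> \<longlongrightarrow> 0) F"
proof (rule order_tendstoI)
  fix e :: real
  assume e: "0 < e"
  have B: "0 \<le> B"
    using nonneg bdd order_trans by blast
  \<comment> \<open>The value e/2 is the fixed point of b |-> b/2 + e/4, so each use of
    \<open>step\<close> with slack e/4 halves the excess over e/2.\<close>
  have iter: "eventually (\<lambda>x. \<phi> x \<le> B / 2 ^ j + e / 2) F" for j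
  proof (induction j)
    case 0
    show ?case
      using bdd e by (intro always_eventually allI) (simp add: add_increasing2)
  next
    case (Suc j)
    have "eventually (\<lambda>x. \<phi> x \<le> (B / 2 ^ j + e / 2) / 2 + e / 4) F"
      by (rule step) (use B e Suc in auto)
    moreover have "(B / 2 ^ j + e / 2) / 2 + e / 4 = B / 2 ^ Suc j + e / 2"
      by (simp add: field_simps)
    ultimately show ?case
      by simp
  qed
  obtain j where "B / (e / 2) < 2 ^ j"
    using real_arch_pow[of 2] by auto
  then have "B / 2 ^ j < e / 2"
    using e by (simp add: field_simps)
  then have less: "B / 2 ^ j + e / 2 < e"
    by linarith
  show "eventually (\<lambda>x. \<phi> x < e) F"
    using iter[of j] by eventually_elim (use less in linarith)
qed (use nonneg in \<open>auto intro!: always_eventually intro: less_le_trans\<close>)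

text \<open>The budget b/2 + e is spent as C M b \<le> b/2 on the feedback of \<open>u\<close>, C d
  = e/2 on \<open>g0\<close> outside a large ball, and e/2 on the potential of the inner part far
  away.\<close>

lemma eventually_halving_step:
  fixes k C M :: real and u f g0 :: "real^'n \<Rightarrow> real"
  defines "\<phi> \<equiv> \<lambda>x. (1 + norm x) powr k * (\<bar>u x\<bar> + norm (grad u x))"
  assumes n: "CARD('n) \<ge> 3"
    and k: "0 < k" "k < real CARD('n) - 2"
    and C_pos: "C > 0"
    and C_bound: "\<And>f :: real^'n \<Rightarrow> real. f \<in> E_space (k + 2) \<Longrightarrow>
          newton_potential f \<in> F_space k \<and>
          F_norm k (newton_potential f) \<le> ennreal C * E_norm (k + 2) f"
    and M: "0 \<le> M" "C * M \<le> 1 / 2"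
    and f: "f \<in> E_space (k + 2)"
    and f_le: "AE x in lebesgue. (1 + norm x) powr (k + 2) * \<bar>f x\<bar> \<le> (1 + norm x) powr (k + 2) * \<bar>g0 x\<bar> + M * \<phi> x"
    and u_eq: "u = newton_potential f"
    and g0_lim: "((\<lambda>x. (1 + norm x) powr (k + 2) * \<bar>g0 x\<bar>) \<longlongrightarrow> 0) at_infinity"
    and b: "0 \<le> b" "eventually (\<lambda>x. \<phi> x \<le> b) at_infinity" and e: "0 < e"
  shows "eventually (\<lambda>x. \<phi> x \<le> b / 2 + e) at_infinity"
proof -
  define d where "d = e / (2 * C)"
  have d: "0 < d" "C * d = e / 2"
    using e C_pos by (simp_all add: d_def)
  have "eventually (\<lambda>x. \<phi> x \<le> b \<and> (1 + norm x) powr (k + 2) * \<bar>g0 x\<bar> \<le> d) at_infinity"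
    using b(2) order_tendstoD(2)[OF g0_lim d(1)] by eventually_elim simp
  then obtain R0 where R0: "\<And>x. R0 \<le> norm x \<Longrightarrow> \<phi> x \<le> b \<and> (1 + norm x) powr (k + 2) * \<bar>g0 x\<bar> \<le> d"
    unfolding eventually_at_infinity by blast
  define R where "R = max 0 R0"
  have R: "0 \<le> R" "\<And>x. R < norm x \<Longrightarrow> \<phi> x \<le> b \<and> (1 + norm x) powr (k + 2) * \<bar>g0 x\<bar> \<le> d"
    using R0 by (auto simp: R_def)
  \<comment> \<open>Both parts stay in \<open>E_space (k + 2)\<close>, so that the potential is
    additive on them and each potential lies in \<open>F_space k\<close>, hence is
    differentiable.\<close>
  define f1 where "f1 = (\<lambda>x. indicator (cball 0 R) x * f x)"
  define f2 where "f2 = (\<lambda>x. indicator (- cball 0 R) x * f x)"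
  obtain B where B: "0 \<le> B" "AE x in lebesgue. (1 + norm x) powr (k + 2) * norm (f x) \<le> B"
    and meas: "f \<in> borel_measurable lebesgue"
    using E_spaceE[OF f] by blast
  have meas1: "f1 \<in> borel_measurable lebesgue" and meas2: "f2 \<in> borel_measurable lebesgue"
    unfolding f1_def f2_def using meas by (auto intro!: borel_measurable_times borel_measurable_indicator)
  have "AE x in lebesgue. (1 + norm x) powr (k + 2) * norm (f1 x) \<le> B"
    using B(2) by eventually_elim (use B(1) in \<open>auto simp: f1_def split: split_indicator\<close>)
  from E_norm_leI[OF meas1 this] have f1: "f1 \<in> E_space (k + 2)"
    by (simp add: E_space_def order_le_less_trans)
  have "AE x in lebesgue. (1 + norm x) powr (k + 2) * norm (f2 x) \<le> d + M * b"
    using f_le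
  proof eventually_elim
    case (elim x)
    show ?case
    proof (cases "R < norm x")
      case True
      then have "M * \<phi> x \<le> M * b"
        using R(2) M(1) by (intro mult_left_mono) auto
      then show ?thesis
        using elim R(2)[OF True] True by (simp add: f2_def)
    next
      case False
      then show ?thesis
        using d(1) M(1) b(1) by (simp add: f2_def)
    qed
  qed
  note f2_le = E_norm_leI[OF meas2 this]
  then have f2: "f2 \<in> E_space (k + 2)"
    by (simp add: E_space_def order_le_less_trans)
  define v1 v2 where "v1 = newton_potential f1" and "v2 = newton_potential f2"
  have v1: "v1 \<in> F_space k" and v2: "v2 \<in> F_space k"
    using C_bound f1 f2 by (auto simp: v1_def v2_def)
  have "F_norm k v2 \<le> ennreal C * E_norm (k + 2) f2"
    using C_bound[OF f2] by (simp add: v2_def)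
  also have "\<dots> \<le> ennreal C * ennreal (d + M * b)"
    using f2_le by (rule mult_left_mono) simp
  also have "\<dots> = ennreal (C * (d + M * b))"
    using C_pos d(1) M(1) b(1) by (simp add: ennreal_mult)
  finally have "F_norm k v2 \<le> ennreal (C * (d + M * b))" .
  \<comment> \<open>\<open>F_norm\<close> is a true supremum, so this bound holds at every point and
    not just almost everywhere.\<close>
  then have v2_le: "(1 + norm x) powr k * (\<bar>v2 x\<bar> + norm (grad v2 x)) \<le> C * (d + M * b)" for x
    using C_pos d(1) M(1) b(1) by (subst (asm) F_norm_le_iff) auto
  have "C * (d + M * b) \<le> e / 2 + b / 2"
    using d(2) mult_right_mono[OF M(2) b(1)] by (simp add: algebra_simps)
  note v2_le = order_trans[OF v2_le this]
  have "integrable lebesgue f1"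
  proof -
    \<comment> \<open>The weight is at least 1, so \<open>f\<close> itself is bounded by
      \<open>B\<close> almost everywhere on this ball of finite measure.\<close>
    have "AE x in lebesgue. x \<in> cball 0 R \<longrightarrow> norm (f x) \<le> B"
      using B(2)
    proof eventually_elim
      case (elim x)
      have "1 * norm (f x) \<le> (1 + norm x) powr (k + 2) * norm (f x)"
        using k by (intro mult_right_mono ge_one_powr_ge_zero) auto
      then show ?case
        using elim by simp
    qed
    moreover have "emeasure lebesgue (cball (0::real^'n) R) < \<infinity>"
      using emeasure_lborel_cball_finite[of "0::real^'n" R] by simp
    ultimately have "integrable lebesgue (\<lambda>x. indicator (cball 0 R) x *\<^sub>R f x)"
      using meas by (intro integrableI_bounded_set_indicator) auto
    then show ?thesis
      by (simp add: f1_def)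
  qed
  then have "((\<lambda>x. (1 + norm x) powr k * (\<bar>v1 x\<bar> + norm (grad v1 x))) \<longlongrightarrow> 0) at_infinity"
    unfolding v1_def using n k R(1) F_spaceD(1)[OF v1]
    by (intro tendsto_weighted_compact_potential[where R = R]) (auto simp: f1_def v1_def)
  then have "eventually (\<lambda>x. (1 + norm x) powr k * (\<bar>v1 x\<bar> + norm (grad v1 x)) < e / 2) at_infinity"
    using e by (intro order_tendstoD) auto
  then show ?thesis
  proof eventually_elim
    case (elim x)
    have "f = (\<lambda>y. f1 y + f2 y)"
      by (auto simp: f1_def f2_def split: split_indicator)
    then have u_sum: "u = (\<lambda>x. v1 x + v2 x)"
      using newton_potential_add[OF n k(1) f1 f2] by (auto simp: u_eq v1_def v2_def)
    then have "grad u x = grad v1 x + grad v2 x"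
      using GDERIV_add[OF GDERIV_grad[OF F_spaceD(1)[OF v1]] GDERIV_grad[OF F_spaceD(1)[OF v2]]]
      by (auto intro: grad_eq)
    then have "norm (grad u x) \<le> norm (grad v1 x) + norm (grad v2 x)"
      by (simp add: norm_triangle_ineq)
    moreover have "\<bar>u x\<bar> \<le> \<bar>v1 x\<bar> + \<bar>v2 x\<bar>"
      by (simp add: u_sum abs_triangle_ineq)
    ultimately have "\<phi> x \<le> (1 + norm x) powr k * ((\<bar>v1 x\<bar> + norm (grad v1 x)) + (\<bar>v2 x\<bar> + norm (grad v2 x)))"
      unfolding \<phi>_def by (intro mult_left_mono) auto
    also have "\<dots> = (1 + norm x) powr k * (\<bar>v1 x\<bar> + norm (grad v1 x)) + (1 + norm x) powr k * (\<bar>v2 x\<bar> + norm (grad v2 x))"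
      by (rule distrib_left)
    finally show ?case
      using elim v2_le[of x] by linarith
  qed
qed

section \<open>Decay of the solution at infinity\<close>

theorem theorem1p9:
  fixes k C Q \<epsilon> :: real
    and g :: "real^'n \<Rightarrow> real \<Rightarrow> real^'n \<Rightarrow> real"
    and u :: "real^'n \<Rightarrow> real"
  assumes n: "CARD('n) \<ge> 3"
    and k: "0 < k" "k < real CARD('n) - 2"
    and C_pos: "C > 0"
    and C_bound: "\<And>f :: real^'n \<Rightarrow> real. f \<in> E_space (k + 2) \<Longrightarrow>
          newton_potential f \<in> F_space k \<and>
          F_norm k (newton_potential f) \<le> ennreal C * E_norm (k + 2) f"
    and Q: "Q = 1 / (2 * C)"
    and H1: "\<And>x. C1_on (UNIV - {(0, 0)}) (\<lambda>(z, p). g x z p)"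
            "\<And>x. continuous_on UNIV (\<lambda>(z, p). g x z p)"
    and H2: "(\<lambda>x. g x 0 0) \<in> E_space (k + 2)"
    and H3: "\<exists>\<delta>>0. D_zp_sup k g \<delta> < \<infinity>"
    and eps_pos: "\<epsilon> > 0"
    and eps_D: "D_zp_sup k g \<epsilon> < ennreal Q"
    and eps_g0: "E_norm (k + 2) (\<lambda>x. g x 0 0) \<le> ennreal (\<epsilon> * Q)"
    and u_F: "u \<in> F_space k"
    and u_le: "F_norm k u \<le> ennreal \<epsilon>"
    and u_eq: "\<And>x. u x = newton_potential (\<lambda>y. g y (u y) (grad u y)) x"
    and g0_lim: "((\<lambda>x. (1 + norm x) powr (k + 2) * \<bar>g x 0 0\<bar>) \<longlongrightarrow> 0) at_infinity"
  shows "((\<lambda>x. (1 + norm x) powr k * (\<bar>u x\<bar> + norm (grad u x))) \<longlongrightarrow> 0) at_infinity"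
proof (cases "(\<lambda>y. g y (u y) (grad u y)) \<in> borel_measurable lebesgue")
  case False
  then have u0: "u = (\<lambda>x. 0)"
    by (intro ext trans[OF u_eq] newton_potential_non_measurable)
  have "grad u x = 0" for x
    unfolding u0 by (rule grad_eq) (rule GDERIV_const)
  then show ?thesis
    by (simp add: u0)
next
  case meas: True
  define \<phi> where "\<phi> = (\<lambda>x. (1 + norm x) powr k * (\<bar>u x\<bar> + norm (grad u x)))"
  define f where "f = (\<lambda>y. g y (u y) (grad u y))"
  \<comment> \<open>The supremum lies below the real number \<open>Q\<close>, so it is finite and
    \<open>M\<close> represents it faithfully.\<close>
  define M where "M = enn2real (D_zp_sup k g \<epsilon>)"
  have M_eq: "D_zp_sup k g \<epsilon> = ennreal M"
    using less_trans[OF eps_D ennreal_less_top] by (simp add: M_def)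
  have M: "0 \<le> M"
    by (simp add: M_def)
  have "M < Q"
    using eps_D M by (simp add: M_eq ennreal_less_iff)
  \<comment> \<open>The choice Q = 1/(2C) is what makes the contraction factor C M at most
    1/2.\<close>
  then have CM: "C * M \<le> 1 / 2"
    using C_pos Q by (simp add: field_simps)
  have \<phi>_nonneg: "0 \<le> \<phi> x" for x
    by (simp add: \<phi>_def)
  have \<phi>_le: "\<phi> x \<le> \<epsilon>" for x
    using u_le eps_pos by (simp add: \<phi>_def F_norm_le_iff)
  have f_le: "AE x in lebesgue. (1 + norm x) powr (k + 2) * \<bar>f x\<bar>
      \<le> (1 + norm x) powr (k + 2) * \<bar>g x 0 0\<bar> + M * \<phi> x"
    using AE_nonlinearity_increment[OF H1 u_F u_le eq_refl[OF M_eq] M]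
  proof eventually_elim
    case (elim x)
    have "\<bar>f x\<bar> \<le> \<bar>g x 0 0\<bar> + M * (1 + norm x) powr - 2 * (\<bar>u x\<bar> + norm (grad u x))"
      using elim unfolding f_def by linarith
    then have "(1 + norm x) powr (k + 2) * \<bar>f x\<bar>
        \<le> (1 + norm x) powr (k + 2) * (\<bar>g x 0 0\<bar> + M * (1 + norm x) powr - 2 * (\<bar>u x\<bar> + norm (grad u x)))"
      by (rule mult_left_mono) simp
    also have "\<dots> = (1 + norm x) powr (k + 2) * \<bar>g x 0 0\<bar>
        + M * (((1 + norm x) powr (k + 2) * (1 + norm x) powr - 2) * (\<bar>u x\<bar> + norm (grad u x)))"
      by (simp only: distrib_left mult_ac)
    \<comment> \<open>The decay of order 2 of the derivative of \<open>g\<close> bridges the weight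
      k+2 of the density and the weight k of the solution.\<close>
    also have "(1 + norm x) powr (k + 2) * (1 + norm x) powr - 2 = (1 + norm x) powr k"
      unfolding powr_add[symmetric] by simp
    finally show ?case
      by (simp only: \<phi>_def)
  qed
  \<comment> \<open>Measurability is the present case; the weighted bound combines the one on
    g(x,0,0) with \<open>\<phi>_le\<close>.\<close>
  have f: "f \<in> E_space (k + 2)"
  proof -
    obtain G where G: "AE x in lebesgue. (1 + norm x) powr (k + 2) * norm (g x 0 0) \<le> G"
      using E_spaceE[OF H2] by blast
    have "AE x in lebesgue. (1 + norm x) powr (k + 2) * norm (f x) \<le> G + M * \<epsilon>"
      using f_le G
    proof eventually_elim
      case (elim x)
      then show ?case
        using mult_left_mono[OF \<phi>_le[of x] M] by simp
    qed
    from E_norm_leI[OF _ this] show ?thesis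
      using meas by (simp add: E_space_def f_def order_le_less_trans)
  qed
  have u_f: "u = newton_potential f"
    unfolding f_def by (intro ext u_eq)
  have "(\<phi> \<longlongrightarrow> 0) at_infinity"
  proof (rule tendsto_0_of_contraction[OF \<phi>_nonneg \<phi>_le])
    show "eventually (\<lambda>x. \<phi> x \<le> b / 2 + e) at_infinity"
      if "0 \<le> b" "0 < e" "eventually (\<lambda>x. \<phi> x \<le> b) at_infinity" for b e
      unfolding \<phi>_def
      by (rule eventually_halving_step[OF n k C_pos C_bound M CM f f_le[unfolded \<phi>_def] u_f g0_lim
            that(1) that(3)[unfolded \<phi>_def] that(2)])
  qed
  then show ?thesis
    by (simp add: \<phi>_def)
qed

end
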